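(* Let $\alpha,\beta$ be non-zero real numbers and let $f$ be a tropical meromorphic function satisfying $$\alpha f(x)+\beta f(x+1)=1\qquad\text{for all }x\in\mathbb{R}.$$ Then: (i) if $\alpha=\beta$, then $f(x)=\Xi(x)+\frac{1}{2\beta}$ for some $2$-periodic, anti-$1$-periodic tropical meromorphic function $\Xi$; (ii) if $\alpha=-\beta$, then $f(x)=\Pi(x)+\frac{1}{\beta}x$ for some $1$-periodic tropical meromorphic function $\Pi$; (iii) if $\alpha\neq\pm\beta$, then $f(x)=\sum_{j=1}^{q}\beta_j\,e_{-\alpha/\beta}(x-b_j)+\frac{1}{\alpha+\beta}$ for some integer $q\ge 0$, real numbers $\beta_1,\dots,\beta_q$ and points $b_1,\dots,b_q\in[0,1)$.
   Context: A tropical meromorphic function is a continuous piecewise linear function $f:\mathbb{R}\to\mathbb{R}$ (arbitrary real slopes, points of slope change having no accumulation point in $\mathbb{R}$). Anti-$1$-periodic means $\Xi(x+1)=-\Xi(x)$ for all $x$; $1$-periodic means $\Pi(x+1)=\Pi(x)$. $[x]$ is the integer part (floor) of $x$. Tropical exponentials: for real $c$ with $|c|>1$, $e_c(x)=c^{[x]}\left(x-[x]+\frac{1}{c-1}\right)$; for real $c$ with $0<|c|<1$, $e_c(x)=c^{[x]}\left(\frac{1}{1-c}-x+[x]\right)$. *)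

theory Defs
  imports "HOL-Analysis.Analysis" "HOL-Library.Periodic_Fun"
begin

text \<open>
  The set \<open>S\<close> of break points contains the points of slope change; as \<open>S\<close> has no accumulation
  point in the real line, every bounded interval meets it in a finite set. The slopes are arbitrary
  real numbers.
\<close>

definition tropical_meromorphic :: "(real \<Rightarrow> real) \<Rightarrow> bool" where
  "tropical_meromorphic f \<longleftrightarrow>
     continuous_on UNIV f \<and>
     (\<exists>S. (\<forall>x. \<not> x islimpt S) \<and>
          (\<forall>u v. u < v \<and> {u<..<v} \<inter> S = {} \<longrightarrow>
             (\<exists>m k. \<forall>x\<in>{u<..<v}. f x = m * x + k)))"

definition anti_periodic :: "(real \<Rightarrow> real) \<Rightarrow> real \<Rightarrow> bool" where
  "anti_periodic f p \<longleftrightarrow> (\<forall>x. f (x + p) = - f x)"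

text \<open>
  The tropical exponential is meaningful only for \<open>c \<noteq> 0\<close> with \<open>\<bar>c\<bar> \<noteq> 1\<close>; the second branch is
  the formula for \<open>0 < \<bar>c\<bar> < 1\<close>, and the values for \<open>c = 0\<close> or \<open>\<bar>c\<bar> = 1\<close> are junk.
\<close>

definition tropical_exp :: "real \<Rightarrow> real \<Rightarrow> real" where
  "tropical_exp c x =
     (if \<bar>c\<bar> > 1 then c powi \<lfloor>x\<rfloor> * (x - of_int \<lfloor>x\<rfloor> + 1 / (c - 1))
      else c powi \<lfloor>x\<rfloor> * (1 / (1 - c) - x + of_int \<lfloor>x\<rfloor>))"

end

theory Submission
  imports Defs
begin

text \<open>
  In case (iii) put \<open>c = - \<alpha> / \<beta>\<close>; then \<open>g = f - 1 / (\<alpha> + \<beta>)\<close> satisfies \<open>g (x + 1) = c * g x\<close>, so it is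
  determined by its values on \<open>[0, 1)\<close>. There \<open>g\<close> is an affine function plus a combination of hinges
  \<open>max 0 (x - b)\<close>. The function \<open>tropical_exp c (x - b)\<close> satisfies the same functional
  equation and is on \<open>[0, 1]\<close> an affine function plus a non-zero multiple of the hinge at \<open>b\<close>.
  Subtracting suitable multiples leaves a solution that is affine on \<open>[0, 1]\<close>, and the condition
  \<open>g 1 = c * g 0\<close> makes it a multiple of \<open>tropical_exp c\<close>.
\<close>

section \<open>Piecewise affine functions and hinges\<close>

lemma tropical_meromorphic_add_affine:
  assumes "tropical_meromorphic f"
  shows "tropical_meromorphic (\<lambda>x. f x + (a * x + b))"
proof -
  obtain S where S: "\<And>x. \<not> x islimpt S"
    and aff: "\<And>u v. u < v \<Longrightarrow> {u<..<v} \<inter> S = {} \<Longrightarrow> \<exists>m k. \<forall>x\<in>{u<..<v}. f x = m * x + k"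
    and cont: "continuous_on UNIV f"
    using assms unfolding tropical_meromorphic_def by blast
  have "\<exists>m k. \<forall>x\<in>{u<..<v}. f x + (a * x + b) = m * x + k"
    if uv: "u < v" "{u<..<v} \<inter> S = {}" for u v
  proof -
    obtain m k where "\<forall>x\<in>{u<..<v}. f x = m * x + k"
      using aff[OF uv] by blast
    then have "\<forall>x\<in>{u<..<v}. f x + (a * x + b) = (m + a) * x + (k + b)"
      by (simp add: algebra_simps)
    then show ?thesis by blast
  qed
  then show ?thesis
    unfolding tropical_meromorphic_def using S cont
    by (intro conjI exI[of _ S] continuous_on_add continuous_on_mult_left
        continuous_on_const continuous_on_id) auto
qed

text \<open>By continuity the formula passes to the end points, which lets two affine pieces be
  compared at the break point they share.\<close>

lemma affine_on_closed_interval: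
  fixes g :: "real \<Rightarrow> real"
  assumes "u < v" "continuous_on {u..v} g" "\<forall>x\<in>{u<..<v}. g x = m * x + k" "x \<in> {u..v}"
  shows "g x = m * x + k"
proof -
  have cl: "closure {u<..<v} = {u..v}"
    using assms(1) by simp
  have "g x - m * x = k"
  proof (rule continuous_constant_on_closure[where f = "\<lambda>x. g x - m * x"])
    show "continuous_on (closure {u<..<v}) (\<lambda>x. g x - m * x)"
      unfolding cl using assms(2) by (intro continuous_intros)
  qed (use assms(3,4) cl in auto)
  then show ?thesis by simp
qed

text \<open>Two distinct points of the overlap determine the slope.\<close>

lemma affine_slope_unique:
  fixes g :: "real \<Rightarrow> real"
  assumes "\<forall>x\<in>{u<..<v}. g x = m * x + k" "\<forall>x\<in>{u'<..<v'}. g x = m' * x + k'"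
    and "max u u' < min v v'"
  shows "m = m'"
proof -
  obtain x where x: "max u u' < x" "x < min v v'" using dense[OF assms(3)] by blast
  obtain y where y: "x < y" "y < min v v'" using dense[OF x(2)] by blast
  have "g x = m * x + k" "g y = m * y + k"
    using x y by (auto intro!: assms(1)[rule_format])
  moreover have "g x = m' * x + k'" "g y = m' * y + k'"
    using x y by (auto intro!: assms(2)[rule_format])
  ultimately have "(m - m') * (y - x) = 0" by (simp add: algebra_simps)
  then show ?thesis using y by simp
qed

text \<open>Induction on the break points: subtracting the hinge at \<open>b\<close>, scaled by the
  jump of the slope there, removes the break at \<open>b\<close> and creates no new one.\<close>

lemma piecewise_affine_eq_sum_hinges:
  fixes g :: "real \<Rightarrow> real"
  assumes "finite S" "S \<subseteq> {l<..<r}" "l < r" "continuous_on {l..r} g"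
    and "\<And>u v. u < v \<Longrightarrow> l \<le> u \<Longrightarrow> v \<le> r \<Longrightarrow> {u<..<v} \<inter> S = {}
           \<Longrightarrow> \<exists>m k. \<forall>x\<in>{u<..<v}. g x = m * x + k"
  shows "\<exists>A B d. \<forall>x\<in>{l..r}. g x = A + B * x + (\<Sum>b\<in>S. d b * max 0 (x - b))"
  using assms(1,2,4,5)
proof (induction S arbitrary: g rule: finite_induct)
  case empty
  obtain m k where "\<forall>x\<in>{l<..<r}. g x = m * x + k"
    using empty.prems(3)[of l r] assms(3) by auto
  then have "\<forall>x\<in>{l..r}. g x = k + m * x"
    using affine_on_closed_interval[OF assms(3) empty.prems(2)] by (simp add: add.commute)
  then show ?case by auto
next
  case (insert b S)
  have b: "l < b" "b < r" using insert.prems by auto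
  \<comment> \<open>As \<open>S\<close> is finite, \<open>b\<close> has a neighbourhood that meets
    no other break point; \<open>m1\<close> and \<open>m2\<close> below are the slopes of
    \<open>g\<close> on its left and right halves.\<close>
  have "open ({l<..<r} - S)" "b \<in> {l<..<r} - S"
    using insert.hyps b by (auto intro: finite_imp_closed)
  then obtain e where e: "e > 0" "ball b e \<subseteq> {l<..<r} - S"
    by (meson open_contains_ball)
  define p q where "p = max l (b - e)" and "q = min r (b + e)"
  have pq: "l \<le> p" "p < b" "b < q" "q \<le> r"
    using b e(1) by (auto simp: p_def q_def)
  have "{p<..<q} \<inter> S = {}"
    using e(2) by (auto simp: p_def q_def ball_eq_greaterThanLessThan)
  then have avoid: "{p<..<b} \<inter> insert b S = {}" "{b<..<q} \<inter> insert b S = {}"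
    using pq by (auto simp: disjoint_iff)
  obtain m1 k1 where left: "\<forall>x\<in>{p<..<b}. g x = m1 * x + k1"
    using insert.prems(3)[OF pq(2,1) _ avoid(1)] b by auto
  obtain m2 k2 where right: "\<forall>x\<in>{b<..<q}. g x = m2 * x + k2"
    using insert.prems(3)[OF pq(3) _ pq(4) avoid(2)] b by auto
  define h where "h = (\<lambda>x. g x - (m2 - m1) * max 0 (x - b))"
  have "\<exists>A B d. \<forall>x\<in>{l..r}. h x = A + B * x + (\<Sum>b\<in>S. d b * max 0 (x - b))"
  proof (rule insert.IH)
    show "S \<subseteq> {l<..<r}" using insert.prems by auto
    show "continuous_on {l..r} h"
      unfolding h_def using insert.prems(2) by (intro continuous_intros)
    fix u v assume uv: "u < v" "l \<le> u" "v \<le> r" "{u<..<v} \<inter> S = {}"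
    consider "b \<le> u" | "v \<le> b" | "u < b" "b < v" by linarith
    then show "\<exists>m k. \<forall>x\<in>{u<..<v}. h x = m * x + k"
    proof cases
      case 1
      then obtain m k where "\<forall>x\<in>{u<..<v}. g x = m * x + k"
        using insert.prems(3)[of u v] uv by auto
      then have "\<forall>x\<in>{u<..<v}. h x = (m - (m2 - m1)) * x + (k + (m2 - m1) * b)"
        using 1 by (auto simp: h_def max_def algebra_simps)
      then show ?thesis by blast
    next
      case 2
      then obtain m k where "\<forall>x\<in>{u<..<v}. g x = m * x + k"
        using insert.prems(3)[of u v] uv by auto
      then have "\<forall>x\<in>{u<..<v}. h x = m * x + k"
        using 2 by (auto simp: h_def max_def)
      then show ?thesis by blast
    next
      \<comment> \<open>An interval straddling \<open>b\<close> is cut there. The hinge has slope 0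
        on the left and 1 on the right, so \<open>h\<close> has slope \<open>m1\<close> on both
        sides, and continuity of \<open>g\<close> at \<open>b\<close> makes the two pieces one
        affine function.\<close>
      case 3
      have avoid': "{u<..<b} \<inter> insert b S = {}" "{b<..<v} \<inter> insert b S = {}"
        using uv(4) 3 by (auto simp: disjoint_iff)
      obtain m k where mk: "\<forall>x\<in>{u<..<b}. g x = m * x + k"
        using insert.prems(3)[OF 3(1) uv(2) _ avoid'(1)] b by auto
      obtain m' k' where mk': "\<forall>x\<in>{b<..<v}. g x = m' * x + k'"
        using insert.prems(3)[OF 3(2) _ uv(3) avoid'(2)] b by auto
      have "m = m1"
        using 3 pq by (intro affine_slope_unique[OF mk left]) auto
      have "m' = m2"
        using 3 pq by (intro affine_slope_unique[OF mk' right]) auto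
      have cont: "continuous_on {u..b} g" "continuous_on {b..v} g"
        using uv b by (auto intro: continuous_on_subset[OF insert.prems(2)])
      note gl = affine_on_closed_interval[OF 3(1) cont(1) mk]
        and gr = affine_on_closed_interval[OF 3(2) cont(2) mk']
      have join: "m * b + k = m' * b + k'" using gl[of b] gr[of b] 3 by simp
      have "h x = m1 * x + k" if x: "x \<in> {u<..<v}" for x
      proof (cases "x \<le> b")
        case True
        then show ?thesis using gl[of x] x \<open>m = m1\<close> by (simp add: h_def)
      next
        case False
        then show ?thesis
          using gr[of x] x join \<open>m = m1\<close> \<open>m' = m2\<close> by (simp add: h_def algebra_simps)
      qed
      then show ?thesis by blast
    qed
  qed
  then obtain A B d where ABd:
    "\<forall>x\<in>{l..r}. h x = A + B * x + (\<Sum>b\<in>S. d b * max 0 (x - b))" by blast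
  \<comment> \<open>Since \<open>b\<close> lies outside \<open>S\<close>, storing the coefficient of
    the new hinge in \<open>d\<close> leaves the old sum unchanged.\<close>
  have "(\<Sum>a\<in>S. (d(b := m2 - m1)) a * max 0 (x - a)) = (\<Sum>a\<in>S. d a * max 0 (x - a))" for x
    using insert.hyps by (intro sum.cong) auto
  then have "\<forall>x\<in>{l..r}. g x = A + B * x + (\<Sum>a\<in>insert b S. (d(b := m2 - m1)) a * max 0 (x - a))"
    using ABd insert.hyps by (auto simp: h_def algebra_simps)
  then show ?case by blast
qed

section \<open>Solutions of h (x + 1) = c * h x\<close>

lemma multiplicative_shift_int:
  fixes h :: "real \<Rightarrow> real"
  assumes "c \<noteq> 0" "\<And>x. h (x + 1) = c * h x"
  shows "h (x + of_int n) = c powi n * h x"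
proof (induction n rule: int_induct[where k = 0])
  case (step1 i)
  have "h (x + of_int (i + 1)) = c * h (x + of_int i)"
    using assms(2)[of "x + of_int i"] by (simp add: add.assoc)
  then show ?case using step1 assms(1) by (simp add: power_int_add)
next
  case (step2 i)
  have "h (x + of_int i) = c * h (x + of_int (i - 1))"
    using assms(2)[of "x + of_int (i - 1)"] by (simp add: algebra_simps)
  then have "h (x + of_int (i - 1)) = c powi i * h x / c"
    using step2 assms(1) by (simp add: field_simps)
  then show ?case using assms(1) by (simp add: power_int_diff)
qed simp

text \<open>Shifting by the floor reduces every point to its fractional part, with the same factor,
  a power of \<open>c\<close>, for both functions.\<close>

lemma multiplicative_shift_eqI:
  fixes h h' :: "real \<Rightarrow> real"
  assumes "c \<noteq> 0" "\<And>x. h (x + 1) = c * h x" "\<And>x. h' (x + 1) = c * h' x"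
    and "\<And>x. x \<in> {0..<1} \<Longrightarrow> h x = h' x"
  shows "h x = h' x"
proof -
  have "h (frac x) = h' (frac x)"
    using assms(4)[of "frac x"] frac_lt_1[of x] by simp
  moreover have "x = frac x + of_int \<lfloor>x\<rfloor>" by (simp add: frac_def)
  ultimately show ?thesis
    using multiplicative_shift_int[of c h] multiplicative_shift_int[of c h'] assms(1-3) by metis
qed

section \<open>Tropical exponentials on the unit interval\<close>

text \<open>The two branches of \<^const>\<open>tropical_exp\<close> differ only by the sign \<open>s\<close>.\<close>

lemma tropical_exp_signed:
  fixes c :: real
  obtains s where "s \<in> {1, -1}"
    "\<And>x. tropical_exp c x = s * (c powi \<lfloor>x\<rfloor> * (x - of_int \<lfloor>x\<rfloor> + 1 / (c - 1)))"
proof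
  show "(if \<bar>c\<bar> > 1 then 1 else -1) \<in> {1, -1 :: real}" by simp
  have "1 / (1 - c) = - (1 / (c - 1))"
    by (metis minus_diff_eq minus_divide_right)
  then show "tropical_exp c x = (if \<bar>c\<bar> > 1 then 1 else -1) *
      (c powi \<lfloor>x\<rfloor> * (x - of_int \<lfloor>x\<rfloor> + 1 / (c - 1)))" for x
    by (simp add: tropical_exp_def algebra_simps)
qed

lemma tropical_exp_shift:
  assumes "c \<noteq> 0"
  shows "tropical_exp c (x + 1) = c * tropical_exp c x"
  using assms by (simp add: tropical_exp_def power_int_add)

text \<open>Here x - b lies in (-1, 1], so its floor is -1 left of \<open>b\<close> and 0 from
  \<open>b\<close> on, except that it is 1 when b = 0 and x = 1. Up to the sign \<open>s\<close>,
  the slope is 1 / c and then 1, and the constant 1 / (c - 1) makes adjacent pieces meet.\<close>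

lemma tropical_exp_hinge:
  fixes c :: real
  assumes "c \<noteq> 0" "c \<noteq> 1"
  obtains s where "s \<in> {1, -1}"
    "\<And>b x. b \<in> {0..<1} \<Longrightarrow> x \<in> {0..1} \<Longrightarrow>
      s * tropical_exp c (x - b) = 1 / (c - 1) + (x - b) / c + (1 - 1 / c) * max 0 (x - b)"
proof -
  obtain s where s: "s \<in> {1, -1}"
    and E: "\<And>x. tropical_exp c x = s * (c powi \<lfloor>x\<rfloor> * (x - of_int \<lfloor>x\<rfloor> + 1 / (c - 1)))"
    using tropical_exp_signed by blast
  have ss: "s * (s * t) = t" for t using s by auto
  have "s * tropical_exp c (x - b) = 1 / (c - 1) + (x - b) / c + (1 - 1 / c) * max 0 (x - b)"
    if bx: "b \<in> {0..<1}" "x \<in> {0..1}" for b x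
  proof -
    consider "x - b < 0" | "0 \<le> x - b" "x - b < 1" | "x - b = 1"
      using bx unfolding atLeastLessThan_iff atLeastAtMost_iff by linarith
    then show ?thesis
    proof cases
      case 1
      then have "\<lfloor>x - b\<rfloor> = -1" using bx by (intro floor_unique) auto
      moreover have "max 0 (x - b) = 0" using 1 by simp
      ultimately show ?thesis
        using assms by (simp only: E ss) (simp add: power_int_minus divide_simps, simp add: algebra_simps)
    next
      case 2
      then have "\<lfloor>x - b\<rfloor> = 0" by (intro floor_unique) auto
      moreover have "max 0 (x - b) = x - b" using 2 by simp
      ultimately show ?thesis
        by (simp only: E ss) (simp add: algebra_simps)
    next
      case 3
      then show ?thesis
        using assms by (simp only: E ss) (simp add: divide_simps, simp add: algebra_simps)
    qed
  qed
  with s that show ?thesis by blast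
qed

section \<open>Decomposition into tropical exponentials\<close>

lemma multiplicative_shift_eq_sum_tropical_exp:
  fixes g :: "real \<Rightarrow> real"
  assumes c: "c \<noteq> 0" "c \<noteq> 1"
    and g: "tropical_meromorphic g" "\<And>x. g (x + 1) = c * g x"
  obtains S w where "finite S" "S \<subseteq> {0..<1}" "\<And>x. g x = (\<Sum>b\<in>S. w b * tropical_exp c (x - b))"
proof -
  obtain T where T: "\<And>x. \<not> x islimpt T" and cont: "continuous_on UNIV g"
    and aff: "\<And>u v. u < v \<Longrightarrow> {u<..<v} \<inter> T = {} \<Longrightarrow> \<exists>m k. \<forall>x\<in>{u<..<v}. g x = m * x + k"
    using g(1) unfolding tropical_meromorphic_def by blast
  \<comment> \<open>Breaks at 0 or 1 do not affect the hinge form on [0, 1], so only interior ones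
    are kept; they are finitely many by compactness.\<close>
  define S where "S = {0<..<1} \<inter> T"
  have "finite ({0..1} \<inter> T)"
    using T by (intro finite_not_islimpt_in_compact) auto
  then have fin: "finite S" by (rule rev_finite_subset) (auto simp: S_def)
  have "\<exists>A B d. \<forall>x\<in>{0..1}. g x = A + B * x + (\<Sum>b\<in>S. d b * max 0 (x - b))"
  proof (rule piecewise_affine_eq_sum_hinges[OF fin])
    show "continuous_on {0..1} g" by (rule continuous_on_subset[OF cont]) simp
    fix u v :: real assume "u < v" "0 \<le> u" "v \<le> 1" "{u<..<v} \<inter> S = {}"
    then show "\<exists>m k. \<forall>x\<in>{u<..<v}. g x = m * x + k"
      by (intro aff) (auto simp: S_def)
  qed (auto simp: S_def)
  then obtain A B d where
    gx: "\<And>x. x \<in> {0..1} \<Longrightarrow> g x = A + B * x + (\<Sum>b\<in>S. d b * max 0 (x - b))" by blast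
  obtain s where E: "\<And>b x. b \<in> {0..<1} \<Longrightarrow> x \<in> {0..1} \<Longrightarrow>
      s * tropical_exp c (x - b) = 1 / (c - 1) + (x - b) / c + (1 - 1 / c) * max 0 (x - b)"
    using tropical_exp_hinge[OF c] by blast
  \<comment> \<open>The exponential based at \<open>b\<close>, multiplied by \<open>s\<close>, has
    slope jump 1 - 1 / c, which is non-zero; this weight turns the jump into
    \<open>d b\<close>.\<close>
  define W where "W b = d b / (1 - 1 / c)" for b
  have dW: "d b = W b * (1 - 1 / c)" for b using c by (simp add: W_def)
  define h where "h x = g x - (\<Sum>b\<in>S. W b * s * tropical_exp c (x - b))" for x
  have h_shift: "h (x + 1) = c * h x" for x
  proof -
    have "tropical_exp c (x + 1 - b) = c * tropical_exp c (x - b)" for b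
      using tropical_exp_shift[OF c(1), of "x - b"] by (simp add: algebra_simps)
    then show ?thesis by (simp add: h_def g(2) right_diff_distrib sum_distrib_left mult_ac)
  qed
  \<comment> \<open>The hinges cancel in \<open>h\<close>; what remains are the constants and
    slopes, including those brought in by the exponentials.\<close>
  define A' B' where "A' = A - (\<Sum>b\<in>S. W b * (1 / (c - 1) - b / c))" and "B' = B - (\<Sum>b\<in>S. W b / c)"
  have hx: "h x = A' + B' * x" if x: "x \<in> {0..1}" for x
  proof -
    have "W b * s * tropical_exp c (x - b)
        = W b * (1 / (c - 1) - b / c) + W b / c * x + d b * max 0 (x - b)" if "b \<in> S" for b
    proof -
      have "W b * s * tropical_exp c (x - b)
          = W b * (1 / (c - 1) + (x - b) / c + (1 - 1 / c) * max 0 (x - b))"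
        using E[of b x] that x by (auto simp: S_def mult.assoc)
      then show ?thesis by (simp add: dW algebra_simps diff_divide_distrib)
    qed
    then have "(\<Sum>b\<in>S. W b * s * tropical_exp c (x - b))
        = (\<Sum>b\<in>S. W b * (1 / (c - 1) - b / c)) + (\<Sum>b\<in>S. W b / c) * x
          + (\<Sum>b\<in>S. d b * max 0 (x - b))"
      by (simp add: sum.distrib sum_distrib_right)
    then show ?thesis using gx[OF x] by (simp add: h_def A'_def B'_def algebra_simps)
  qed
  \<comment> \<open>The functional equation at 0 ties the intercept to the slope, so
    \<open>h\<close> is proportional to \<open>tropical_exp c\<close> on [0, 1).\<close>
  have "A' + B' = c * A'" using h_shift[of 0] hx[of 0] hx[of 1] by simp
  then have A': "A' = B' * (1 / (c - 1))" using c by (simp add: field_simps)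
  have h: "h x = B' * s * tropical_exp c x" for x
  proof (rule multiplicative_shift_eqI[where h = h, OF c(1) h_shift])
    fix y :: real assume y: "y \<in> {0..<1}"
    have "s * tropical_exp c y = 1 / (c - 1) + y"
      using E[of 0 y] y c by (simp add: algebra_simps)
    then show "h y = B' * s * tropical_exp c y"
      using hx[of y] y A' by (simp add: algebra_simps)
  qed (simp add: tropical_exp_shift[OF c(1)])
  \<comment> \<open>The weights absorb the sign, and the remainder \<open>h\<close> becomes the term
    with base point 0, which is not in \<open>S\<close>.\<close>
  define w where "w b = (if b = 0 then B' else W b) * s" for b
  have "g x = (\<Sum>b\<in>insert 0 S. w b * tropical_exp c (x - b))" for x
  proof -
    have "0 \<notin> S" by (auto simp: S_def)
    moreover from this have "(\<Sum>b\<in>S. w b * tropical_exp c (x - b))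
        = (\<Sum>b\<in>S. W b * s * tropical_exp c (x - b))"
      by (intro sum.cong) (auto simp: w_def)
    ultimately show ?thesis using h[of x] fin by (simp add: h_def w_def)
  qed
  moreover have "finite (insert 0 S)" "insert 0 S \<subseteq> {0..<1}" using fin by (auto simp: S_def)
  ultimately show ?thesis using that by blast
qed

section \<open>The three cases of the equation\<close>

theorem theorem4p1:
  fixes \<alpha> \<beta> :: real and f :: "real \<Rightarrow> real"
  assumes "\<alpha> \<noteq> 0" and "\<beta> \<noteq> 0"
    and "tropical_meromorphic f"
    and "\<And>x. \<alpha> * f x + \<beta> * f (x + 1) = 1"
  shows "(\<alpha> = \<beta> \<longrightarrow>
            (\<exists>\<Xi>. tropical_meromorphic \<Xi> \<and> periodic_fun_simple \<Xi> 2 \<and> anti_periodic \<Xi> 1 \<and>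
                 (\<forall>x. f x = \<Xi> x + 1 / (2 * \<beta>))))
       \<and> (\<alpha> = - \<beta> \<longrightarrow>
            (\<exists>P. tropical_meromorphic P \<and> periodic_fun_simple P 1 \<and>
                 (\<forall>x. f x = P x + 1 / \<beta> * x)))
       \<and> (\<alpha> \<noteq> \<beta> \<and> \<alpha> \<noteq> - \<beta> \<longrightarrow>
            (\<exists>(q::nat) (w::nat \<Rightarrow> real) (b::nat \<Rightarrow> real).
                 (\<forall>j\<in>{1..q}. b j \<in> {0..<1}) \<and>
                 (\<forall>x. f x = (\<Sum>j=1..q. w j * tropical_exp (- \<alpha> / \<beta>) (x - b j))
                            + 1 / (\<alpha> + \<beta>))))"
proof (intro conjI impI)
  assume eq: "\<alpha> = \<beta>"
  \<comment> \<open>The subtracted constant is itself a solution, so \<Xi> satisfies the homogeneous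
    equation.\<close>
  define \<Xi> where "\<Xi> = (\<lambda>x. f x - 1 / (2 * \<beta>))"
  have f1: "f (x + 1) = 1 / \<beta> - f x" for x
    using assms(4)[of x] assms(2) eq by (simp add: field_simps)
  have anti: "\<Xi> (x + 1) = - \<Xi> x" for x by (simp add: \<Xi>_def f1)
  then have "\<Xi> (x + 2) = \<Xi> x" for x
    using anti[of "x + 1"] by (simp add: add.assoc)
  moreover have "tropical_meromorphic \<Xi>"
    using tropical_meromorphic_add_affine[OF assms(3), of 0 "- 1 / (2 * \<beta>)"] by (simp add: \<Xi>_def)
  ultimately show "\<exists>\<Xi>. tropical_meromorphic \<Xi> \<and> periodic_fun_simple \<Xi> 2 \<and> anti_periodic \<Xi> 1 \<and>
      (\<forall>x. f x = \<Xi> x + 1 / (2 * \<beta>))"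
    using anti by (intro exI[of _ \<Xi>])
      (auto simp: anti_periodic_def \<Xi>_def intro!: periodic_fun_simple.intro)
next
  assume eq: "\<alpha> = - \<beta>"
  \<comment> \<open>Now \<alpha> + \<beta> = 0 and no constant is a solution, but x / \<beta> is: -x
    + (x + 1) = 1.\<close>
  define P where "P = (\<lambda>x. f x - 1 / \<beta> * x)"
  have "f (x + 1) = 1 / \<beta> + f x" for x
    using assms(4)[of x] assms(2) eq by (simp add: field_simps)
  then have "P (x + 1) = P x" for x by (simp add: P_def add_divide_distrib)
  moreover have "tropical_meromorphic P"
    using tropical_meromorphic_add_affine[OF assms(3), of "- 1 / \<beta>" 0] by (simp add: P_def)
  ultimately show "\<exists>P. tropical_meromorphic P \<and> periodic_fun_simple P 1 \<and>
      (\<forall>x. f x = P x + 1 / \<beta> * x)"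
    by (intro exI[of _ P]) (auto simp: P_def intro!: periodic_fun_simple.intro)
next
  assume neq: "\<alpha> \<noteq> \<beta> \<and> \<alpha> \<noteq> - \<beta>"
  define c where "c = - \<alpha> / \<beta>"
  have c: "c \<noteq> 0" "c \<noteq> 1" using assms(1,2) neq by (auto simp: c_def field_simps)
  have ab: "\<alpha> + \<beta> \<noteq> 0" using neq by (simp add: add_eq_0_iff2)
  define g where "g = (\<lambda>x. f x - 1 / (\<alpha> + \<beta>))"
  have "tropical_meromorphic g"
    using tropical_meromorphic_add_affine[OF assms(3), of 0 "- 1 / (\<alpha> + \<beta>)"] by (simp add: g_def)
  moreover have "g (x + 1) = c * g x" for x
  proof -
    \<comment> \<open>That is, the constant 1 / (\<alpha> + \<beta>) is a solution; subtracting it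
      makes the equation homogeneous.\<close>
    have "(\<alpha> + \<beta>) * (1 / (\<alpha> + \<beta>)) = 1" using ab by simp
    then have "\<alpha> * g x + \<beta> * g (x + 1) = 0"
      using assms(4)[of x] unfolding g_def right_diff_distrib distrib_right by linarith
    then show ?thesis using assms(2) by (simp add: c_def field_simps)
  qed
  ultimately obtain S w where S: "finite S" "S \<subseteq> {0..<1}"
    and g: "\<And>x. g x = (\<Sum>b\<in>S. w b * tropical_exp c (x - b))"
    using multiplicative_shift_eq_sum_tropical_exp[OF c] by blast
  \<comment> \<open>With q = \<open>card S\<close>, the set of base points is enumerated from 1 to
    q.\<close>
  obtain b where b: "bij_betw b {1..card S} S"
    using ex_bij_betw_nat_finite_1[OF S(1)] by blast
  have "f x = (\<Sum>j=1..card S. w (b j) * tropical_exp c (x - b j)) + 1 / (\<alpha> + \<beta>)" for x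
    using g[of x] sum.reindex_bij_betw[OF b, of "\<lambda>b. w b * tropical_exp c (x - b)"]
    by (simp add: g_def algebra_simps)
  moreover have "\<forall>j\<in>{1..card S}. b j \<in> {0..<1}"
    using bij_betwE[OF b] S(2) by blast
  ultimately show "\<exists>(q::nat) (w::nat \<Rightarrow> real) (b::nat \<Rightarrow> real).
      (\<forall>j\<in>{1..q}. b j \<in> {0..<1}) \<and>
      (\<forall>x. f x = (\<Sum>j=1..q. w j * tropical_exp (- \<alpha> / \<beta>) (x - b j)) + 1 / (\<alpha> + \<beta>))"
    unfolding c_def by (intro exI[of _ "card S"] exI[of _ "\<lambda>j. w (b j)"] exI[of _ b]) auto
qed

end
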